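(* Let $F=\sum_{j=1}^d a_j\delta(x-x_j)\in\mathcal P_d$ and let $i$, $1\le i\le d-1$, be fixed. The curve $S^x_{F,i}$ is a hyperbola in the plane of $(x'_i,x'_{i+1})$ defined by the equation $$m_0(F)\,x'_ix'_{i+1}-m_1(F)(x'_i+x'_{i+1})+m_2(F)=0.$$ The original curve $S_{F,i}$ is parametrized through $(x'_i,x'_{i+1})$ in $S^x_{F,i}$ as $$a'_i=\frac{m_0(F)x'_{i+1}-m_1(F)}{x'_{i+1}-x'_i},\qquad a'_{i+1}=\frac{-m_0(F)x'_i+m_1(F)}{x'_{i+1}-x'_i},\qquad (x'_i,x'_{i+1})\in S^x_{F,i}.$$
   Context: Signals: $\mathcal P_d=\{(a,x)=(a_1,\dots,a_d,x_1,\dots,x_d)\in\mathbb R^{2d}: x_1<x_2<\dots<x_d\}$. A point $(a,x)\in\mathcal P_d$ is identified with the spike-train signal $F(x)=\sum_{j=1}^d a_j\delta(x-x_j)$, with amplitudes $a_j$ and nodes $x_j$. Moments: $m_k(F)=\int x^kF(x)\,dx=\sum_{j=1}^d a_jx_j^k$. Prony curve: $S_{F,i}\subset\mathcal P_d$ is the set of all signals $F'(x)=\sum_{j=1}^d a'_j\delta(x-x'_j)\in\mathcal P_d$ for which $a'_j=a_j$, $x'_j=x_j$ for all $j\ne i,i+1$, and $m_k(F')=m_k(F)$ for $k=0,1,2$. $S^x_{F,i}$ denotes the projection of $S_{F,i}$ onto the node plane spanned by the node coordinates $x'_i,x'_{i+1}$.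
   Formalization: In the equation and amplitude formulas, m_k(F) is the moment of the two moving spikes only (full moments fail for d>2); "hyperbola" is claimed only if a_i, a_{i+1} and m_0 are nonzero, and S^x is the part of that hyperbola respecting the node order. *)

theory Defs
  imports "HOL-Analysis.Analysis"
begin

text \<open>A signal is a pair \<open>(a, x)\<close> of amplitudes and nodes indexed by \<open>{1..d}\<close>. The space
  \<open>\<real>\<^sup>d\<close> is \<open>{1..d} \<rightarrow>\<^sub>E UNIV\<close>; extensionality makes equality of signals the
  equality of their coordinates. Amplitudes may vanish.\<close>

type_synonym signal = "(nat \<Rightarrow> real) \<times> (nat \<Rightarrow> real)"

definition signal_space :: "nat \<Rightarrow> signal set" where
  "signal_space d =
     {(a, x). a \<in> {1..d} \<rightarrow>\<^sub>E UNIV \<and> x \<in> {1..d} \<rightarrow>\<^sub>E UNIV \<and> strict_mono_on {1..d} x}"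

definition moment :: "nat \<Rightarrow> nat \<Rightarrow> signal \<Rightarrow> real" where
  "moment d k F = (\<Sum>j=1..d. fst F j * snd F j ^ k)"

definition prony_curve :: "nat \<Rightarrow> signal \<Rightarrow> nat \<Rightarrow> signal set" where
  "prony_curve d F i =
     {F' \<in> signal_space d.
        (\<forall>j\<in>{1..d} - {i, i + 1}. fst F' j = fst F j \<and> snd F' j = snd F j) \<and>
        (\<forall>k\<in>{0, 1, 2}. moment d k F' = moment d k F)}"

definition prony_node_curve :: "nat \<Rightarrow> signal \<Rightarrow> nat \<Rightarrow> (real \<times> real) set" where
  "prony_node_curve d F i = (\<lambda>F'. (snd F' i, snd F' (i + 1))) ` prony_curve d F i"

text \<open>The moments of the two-node signal
  \<open>a\<^sub>i \<delta>(x - x\<^sub>i) + a\<^sub>i\<^sub>+\<^sub>1 \<delta>(x - x\<^sub>i\<^sub>+\<^sub>1)\<close> formed by the nodes that are allowed to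
  move. The equation of the node curve and the formulas for the amplitudes hold with these
  moments. For \<open>d = 2\<close> they are the moments of \<open>F\<close> (\<open>pair_moment_two\<close>); for
  \<open>d > 2\<close> the moments of the whole of \<open>F\<close> cannot be used, because the other nodes
  contribute to them (\<open>full_moments_fail\<close>).\<close>

definition pair_moment :: "nat \<Rightarrow> nat \<Rightarrow> signal \<Rightarrow> real" where
  "pair_moment i k F = (\<Sum>j\<in>{i, i + 1}. fst F j * snd F j ^ k)"

lemma pair_moment_two: "pair_moment 1 k F = moment 2 k F"
proof -
  have "{1..2} = {1, 1 + 1::nat}" by auto
  then show ?thesis by (simp only: pair_moment_def moment_def)
qed

lemma full_moments_fail:
  "\<exists>F\<in>signal_space 3. \<exists>(u, v)\<in>prony_node_curve 3 F 1.
     moment 3 0 F * u * v - moment 3 1 F * (u + v) + moment 3 2 F \<noteq> 0"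
proof -
  define F :: signal where "F = (\<lambda>j\<in>{1..3}. 1, \<lambda>j\<in>{1..3}. real j)"
  have F: "F \<in> signal_space 3"
    by (auto simp: F_def signal_space_def strict_mono_on_def)
  then have "F \<in> prony_curve 3 F 1"
    by (auto simp: prony_curve_def)
  then have "(snd F 1, snd F (1 + 1)) \<in> prony_node_curve 3 F 1"
    unfolding prony_node_curve_def by blast
  moreover have "{1..3} = {1, 2, 3::nat}" by auto
  then have "moment 3 0 F * snd F 1 * snd F (1 + 1)
      - moment 3 1 F * (snd F 1 + snd F (1 + 1)) + moment 3 2 F \<noteq> 0"
    by (simp add: moment_def F_def)
  ultimately show ?thesis using F by blast
qed

text \<open>The focal definition; degenerate conics are excluded. The equation
  \<open>m\<^sub>0 u v - m\<^sub>1 (u + v) + m\<^sub>2 = 0\<close> in the moments of the moving pair has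
  \<open>m\<^sub>1\<^sup>2 - m\<^sub>0 m\<^sub>2 = - a\<^sub>i a\<^sub>i\<^sub>+\<^sub>1 (x\<^sub>i\<^sub>+\<^sub>1 - x\<^sub>i)\<^sup>2\<close>.
  Hence it is not a hyperbola when \<open>m\<^sub>0 = 0\<close> (its degree is at most one) or when one
  of the two amplitudes vanishes (it is a pair of lines or trivial).\<close>

definition hyperbola :: "(real \<times> real) set \<Rightarrow> bool" where
  "hyperbola H \<longleftrightarrow>
     (\<exists>f g r. 0 < r \<and> r < dist f g \<and> H = {p. \<bar>dist p f - dist p g\<bar> = r})"

end

theory Submission
  imports Defs
begin

text \<open>Fixing all nodes but two, the three moment equations become a system for the moving pair
  with right-hand sides the moments of that pair. For \<open>u \<noteq> v\<close> the first two are
  solved uniquely for the amplitudes, and the third is then the equation of the node curve. With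
  \<open>h = m\<^sub>1 / m\<^sub>0\<close> this equation is \<open>(u - h) (v - h) = K\<close>, a
  rectangular hyperbola with foci \<open>(h \<plusminus> s, h \<plusminus> s)\<close> for \<open>K > 0\<close> and
  \<open>(h \<plusminus> s, h \<mp> s)\<close> for \<open>K < 0\<close>, where \<open>s\<^sup>2 = 2 \<bar>K\<bar>\<close>.\<close>

text \<open>Two squarings remove the absolute value and the square roots. The sign \<open>e\<close>
  treats foci on the diagonal (\<open>e = 1\<close>) and on the antidiagonal (\<open>e = -1\<close>)
  at once.\<close>

lemma abs_dist_diff_eq_iff:
  fixes h s e u v :: real
  assumes "0 < s" and e: "e\<^sup>2 = 1"
  shows "\<bar>dist (u, v) (h + s, h + e * s) - dist (u, v) (h - s, h - e * s)\<bar> = 2 * s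
    \<longleftrightarrow> 2 * e * (u - h) * (v - h) = s\<^sup>2"
proof -
  define X Y where "X = u - h" and "Y = v - h"
  define A B where "A = dist (u, v) (h + s, h + e * s)" and "B = dist (u, v) (h - s, h - e * s)"
  define N where "N = X\<^sup>2 + Y\<^sup>2"
  have nonneg: "0 \<le> A * B" "0 \<le> N"
    by (simp_all add: A_def B_def N_def)
  have "A\<^sup>2 = (X - s)\<^sup>2 + (Y - e * s)\<^sup>2"
    by (simp add: A_def dist_Pair_Pair dist_real_def X_def Y_def diff_diff_eq)
  then have A: "A\<^sup>2 = N - 2 * s * (X + e * Y) + 2 * s\<^sup>2"
    using e unfolding N_def by algebra
  have "B\<^sup>2 = (X + s)\<^sup>2 + (Y + e * s)\<^sup>2"
    by (simp add: B_def dist_Pair_Pair dist_real_def X_def Y_def algebra_simps)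
  then have B: "B\<^sup>2 = N + 2 * s * (X + e * Y) + 2 * s\<^sup>2"
    using e unfolding N_def by algebra
  have "\<bar>A - B\<bar> = 2 * s \<longleftrightarrow> (A - B)\<^sup>2 = (2 * s)\<^sup>2"
    using assms(1) by (metis abs_of_pos power2_eq_iff_nonneg abs_ge_zero less_imp_le
        mult_pos_pos power2_abs zero_less_numeral)
  \<comment> \<open>The terms linear in \<open>s\<close> cancel in the sum, so
    \<open>A\<^sup>2 + B\<^sup>2 = 2 * N + 4 * s\<^sup>2\<close>.\<close>
  also have "\<dots> \<longleftrightarrow> A * B = N"
    using A B by (simp add: power2_diff power_mult_distrib) linarith
  also have "\<dots> \<longleftrightarrow> (A * B)\<^sup>2 = N\<^sup>2"
    using nonneg by (simp add: power2_eq_iff_nonneg)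
  \<comment> \<open>The product of \<open>A\<^sup>2\<close> and \<open>B\<^sup>2\<close> is a
    difference of two squares, and \<open>(X + e * Y)\<^sup>2 = N + 2 * e * X * Y\<close>.\<close>
  also have "(A * B)\<^sup>2 = N\<^sup>2 + 4 * s\<^sup>2 * (s\<^sup>2 - 2 * e * X * Y)"
  proof -
    have "(A * B)\<^sup>2 = (N + 2 * s\<^sup>2)\<^sup>2 - 4 * s\<^sup>2 * (X + e * Y)\<^sup>2"
      unfolding power_mult_distrib A B by algebra
    then show ?thesis
      using e unfolding N_def by algebra
  qed
  also have "\<dots> = N\<^sup>2 \<longleftrightarrow> 2 * e * X * Y = s\<^sup>2"
    using assms(1) by auto
  finally show ?thesis
    by (simp only: A_def B_def X_def Y_def)
qed

lemma hyperbola_rectangular: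
  fixes h K :: real
  assumes "K \<noteq> 0"
  shows "hyperbola {(u, v). (u - h) * (v - h) = K}"
proof -
  \<comment> \<open>With \<open>e = sgn K\<close>, this choice makes
    \<open>2 * e * K = s\<^sup>2\<close>.\<close>
  define s where "s = sqrt (2 * \<bar>K\<bar>)"
  define e where "e = sgn K"
  have s: "0 < s" "s\<^sup>2 = 2 * \<bar>K\<bar>" and e: "e\<^sup>2 = 1" "e * K = \<bar>K\<bar>"
    using assms by (simp_all add: s_def e_def power2_eq_square sgn_if)
  let ?f = "(h + s, h + e * s)" and ?g = "(h - s, h - e * s)"
  \<comment> \<open>The foci form opposite corners of a square of side \<open>2 * s\<close>, so
    their distance exceeds \<open>2 * s\<close>.\<close>
  have "(dist ?f ?g)\<^sup>2 = (2 * s)\<^sup>2 + (2 * e * s)\<^sup>2"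
    by (simp add: dist_Pair_Pair dist_real_def power_mult_distrib)
  then have "(2 * s)\<^sup>2 < (dist ?f ?g)\<^sup>2"
    using s(1) e(1) by (simp add: power_mult_distrib)
  then have less: "2 * s < dist ?f ?g"
    by (rule power2_less_imp_less) simp
  have "(u - h) * (v - h) = K \<longleftrightarrow> \<bar>dist (u, v) ?f - dist (u, v) ?g\<bar> = 2 * s" for u v
  proof -
    have "(u - h) * (v - h) = K \<longleftrightarrow> e * ((u - h) * (v - h)) = e * K"
      using e(1) by auto
    also have "\<dots> \<longleftrightarrow> 2 * e * (u - h) * (v - h) = s\<^sup>2"
      unfolding s(2) e(2) by (auto simp: mult.assoc)
    finally show ?thesis
      unfolding abs_dist_diff_eq_iff[OF s(1) e(1)] .
  qed
  then have "{(u, v). (u - h) * (v - h) = K} = {p. \<bar>dist p ?f - dist p ?g\<bar> = 2 * s}"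
    by auto
  with s(1) less show ?thesis
    unfolding hyperbola_def by (intro exI[of _ ?f] exI[of _ ?g] exI[of _ "2 * s"]) simp
qed

text \<open>Dividing by \<open>m0\<close> and completing the product moves the centre to
  \<open>m1 / m0\<close> in both coordinates. The second hypothesis keeps the constant away from
  zero, where the conic would split into two lines.\<close>

lemma hyperbola_bilinear:
  fixes m0 m1 m2 :: real
  assumes "m0 \<noteq> 0" and "m1\<^sup>2 \<noteq> m0 * m2"
  shows "hyperbola {(u, v). m0 * u * v - m1 * (u + v) + m2 = 0}"
proof -
  let ?K = "(m1\<^sup>2 - m0 * m2) / m0\<^sup>2"
  have "m0 * u * v - m1 * (u + v) + m2 = 0 \<longleftrightarrow> (u - m1 / m0) * (v - m1 / m0) = ?K" for u v
  proof -
    have "(u - m1 / m0) * (v - m1 / m0) - ?K = (m0 * u * v - m1 * (u + v) + m2) / m0"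
      using assms(1) by (simp add: field_simps power2_eq_square)
    then show ?thesis
      using assms(1) by (metis divide_eq_0_iff eq_iff_diff_eq_0)
  qed
  with hyperbola_rectangular[of ?K "m1 / m0"] assms show ?thesis
    by simp
qed

text \<open>The first two equations are linear in \<open>p\<close> and \<open>q\<close> with
  determinant \<open>v - u\<close>. Since \<open>u\<close> and \<open>v\<close> are the roots of
  \<open>z\<^sup>2 - (u + v) * z + u * v\<close>, the moments obey the recurrence
  \<open>m2 = (u + v) * m1 - u * v * m0\<close>, which is the node equation.\<close>

lemma two_node_moments_iff:
  fixes u v :: real
  assumes "u \<noteq> v"
  shows "p + q = m0 \<and> p * u + q * v = m1 \<and> p * u\<^sup>2 + q * v\<^sup>2 = m2 \<longleftrightarrow>
    p = (m0 * v - m1) / (v - u) \<and> q = (- m0 * u + m1) / (v - u) \<and>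
    m0 * u * v - m1 * (u + v) + m2 = 0" (is "?L \<longleftrightarrow> ?R")
proof -
  have "v - u \<noteq> 0" using assms by simp
  then have "?R \<longleftrightarrow> p * (v - u) = m0 * v - m1 \<and> q * (v - u) = - m0 * u + m1 \<and>
      m0 * u * v - m1 * (u + v) + m2 = 0" (is "_ \<longleftrightarrow> ?R'")
    by (simp add: nonzero_eq_divide_eq)
  also have "\<dots> \<longleftrightarrow> ?L"
  proof
    assume ?L
    then have "m0 = p + q" "m1 = p * u + q * v" "m2 = p * u\<^sup>2 + q * v\<^sup>2" by simp_all
    then show ?R' by (simp add: algebra_simps power2_eq_square)
  next
    assume R: ?R'
    then have "(v - u) * (p + q) = (v - u) * m0" "(v - u) * (p * u + q * v) = (v - u) * m1"
      by algebra+
    with \<open>v - u \<noteq> 0\<close> have eqs: "p + q = m0" "p * u + q * v = m1" by auto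
    with R have "p * u\<^sup>2 + q * v\<^sup>2 = m2" by algebra
    with eqs show ?L by simp
  qed
  finally show ?thesis by simp
qed

lemma pair_moment_eq: "pair_moment i k F = fst F i * snd F i ^ k + fst F (i + 1) * snd F (i + 1) ^ k"
  by (simp add: pair_moment_def)

lemma moment_eq_pair_moment:
  assumes "1 \<le> i" and "i + 1 \<le> d"
  shows "moment d k F = pair_moment i k F + (\<Sum>j\<in>{1..d} - {i, i + 1}. fst F j * snd F j ^ k)"
  unfolding moment_def pair_moment_def
  using sum.subset_diff[of "{i, i + 1}" "{1..d}" "\<lambda>j. fst F j * snd F j ^ k"] assms by simp

text \<open>The fixed nodes contribute equally to the moments of both signals, so their share
  cancels.\<close>

lemma prony_curve_pair_moment:
  assumes "1 \<le> i" and "i + 1 \<le> d"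
  shows "prony_curve d F i =
    {F' \<in> signal_space d.
      (\<forall>j\<in>{1..d} - {i, i + 1}. fst F' j = fst F j \<and> snd F' j = snd F j) \<and>
      (\<forall>k\<in>{0, 1, 2}. pair_moment i k F' = pair_moment i k F)}"
proof -
  have "moment d k F' = moment d k F \<longleftrightarrow> pair_moment i k F' = pair_moment i k F"
    if "\<forall>j\<in>{1..d} - {i, i + 1}. fst F' j = fst F j \<and> snd F' j = snd F j" for k F'
  proof -
    have "(\<Sum>j\<in>{1..d} - {i, i + 1}. fst F' j * snd F' j ^ k) =
        (\<Sum>j\<in>{1..d} - {i, i + 1}. fst F j * snd F j ^ k)"
      using that by (intro sum.cong) auto
    then show ?thesis
      by (simp only: moment_eq_pair_moment[OF assms] add_right_cancel)
  qed
  then show ?thesis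
    unfolding prony_curve_def by blast
qed

text \<open>Outside \<open>{1..d}\<close> extensionality forces both signals to the same default
  value, so only the entries at \<open>i\<close> and \<open>i + 1\<close> can differ.\<close>

lemma signal_space_agree_off_pair:
  assumes "(a, x) \<in> signal_space d" and "(b, y) \<in> signal_space d"
    and "\<forall>j\<in>{1..d} - {i, i + 1}. b j = a j \<and> y j = x j"
  shows "b = a(i := b i, i + 1 := b (i + 1))" "y = x(i := y i, i + 1 := y (i + 1))"
proof -
  have out: "b j = a j \<and> y j = x j" if "j \<notin> {1..d}" for j
    using assms(1,2) that by (auto simp: signal_space_def PiE_def extensional_def)
  have "b j = a j \<and> y j = x j" if "j \<noteq> i" "j \<noteq> i + 1" for j
    using assms(3) out that by blast
  then show "b = a(i := b i, i + 1 := b (i + 1))" "y = x(i := y i, i + 1 := y (i + 1))"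
    by auto
qed

lemma signal_space_upd_amplitude:
  assumes "j \<in> {1..d}" and "(a, y) \<in> signal_space d"
  shows "(a(j := p), y) \<in> signal_space d"
  using assms by (auto simp: signal_space_def PiE_def extensional_def)

lemma signal_space_nodes_less:
  assumes "(a, x) \<in> signal_space d" and "j \<in> {1..d}" and "k \<in> {1..d}" and "j < k"
  shows "x j < x k"
  using assms by (auto simp: signal_space_def strict_mono_on_def)

lemma prony_curve_eq_image:
  fixes a x :: "nat \<Rightarrow> real"
  assumes F: "(a, x) \<in> signal_space d" and i: "1 \<le> i" "i + 1 \<le> d"
  defines "m0 \<equiv> pair_moment i 0 (a, x)" and "m1 \<equiv> pair_moment i 1 (a, x)"
    and "m2 \<equiv> pair_moment i 2 (a, x)"
  shows "prony_curve d (a, x) i =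
    (\<lambda>(u, v).
       (a(i := (m0 * v - m1) / (v - u), i + 1 := (- m0 * u + m1) / (v - u)),
        x(i := u, i + 1 := v))) `
    ({(u, v). m0 * u * v - m1 * (u + v) + m2 = 0} \<inter>
     {(u, v). (a, x(i := u, i + 1 := v)) \<in> signal_space d})"
    (is "?C = ?\<Phi> ` ?D")
proof (intro set_eqI iffI)
  have i_in: "i \<in> {1..d}" "i + 1 \<in> {1..d}" using i by auto
  fix F' assume F': "F' \<in> ?C"
  obtain b y where F'_eq: "F' = (b, y)" by (cases F')
  let ?u = "y i" and ?v = "y (i + 1)"
  from F' have sig: "(b, y) \<in> signal_space d"
    and off: "\<forall>j\<in>{1..d} - {i, i + 1}. b j = a j \<and> y j = x j"
    and mom: "pair_moment i 0 (b, y) = m0" "pair_moment i 1 (b, y) = m1" "pair_moment i 2 (b, y) = m2"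
    unfolding prony_curve_pair_moment[OF i] by (auto simp: F'_eq m0_def m1_def m2_def)
  note upd = signal_space_agree_off_pair[OF F sig off]
  have "?u < ?v"
    using sig i_in by (rule signal_space_nodes_less) simp
  moreover have "b i + b (i + 1) = m0 \<and> b i * ?u + b (i + 1) * ?v = m1 \<and>
      b i * ?u\<^sup>2 + b (i + 1) * ?v\<^sup>2 = m2"
    using mom by (simp add: pair_moment_eq)
  ultimately have sol: "b i = (m0 * ?v - m1) / (?v - ?u)" "b (i + 1) = (- m0 * ?u + m1) / (?v - ?u)"
      "m0 * ?u * ?v - m1 * (?u + ?v) + m2 = 0"
    using two_node_moments_iff[of ?u ?v "b i" "b (i + 1)" m0 m1 m2] by auto
  \<comment> \<open>Membership constrains amplitudes only by extensionality, so \<open>b\<close> may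
    be exchanged for \<open>a\<close>.\<close>
  have "(a, y) \<in> signal_space d"
    using F sig by (auto simp: signal_space_def)
  then have "(a, x(i := ?u, i + 1 := ?v)) \<in> signal_space d"
    by (simp only: upd(2)[symmetric])
  with sol(3) have "(?u, ?v) \<in> ?D" by simp
  moreover have "F' = (a(i := b i, i + 1 := b (i + 1)), x(i := ?u, i + 1 := ?v))"
    by (simp only: F'_eq upd[symmetric])
  then have "F' = ?\<Phi> (?u, ?v)"
    unfolding sol(1,2) by simp
  ultimately show "F' \<in> ?\<Phi> ` ?D" by blast
next
  have i_in: "i \<in> {1..d}" "i + 1 \<in> {1..d}" using i by auto
  fix F' assume "F' \<in> ?\<Phi> ` ?D"
  then obtain u v where F': "F' = ?\<Phi> (u, v)" and eq: "m0 * u * v - m1 * (u + v) + m2 = 0"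
    and sig: "(a, x(i := u, i + 1 := v)) \<in> signal_space d"
    by blast
  define p q where "p = (m0 * v - m1) / (v - u)" and "q = (- m0 * u + m1) / (v - u)"
  have F'': "F' = (a(i := p, i + 1 := q), x(i := u, i + 1 := v))"
    by (simp add: F' p_def q_def)
  \<comment> \<open>The node order makes the denominator \<open>v - u\<close> nonzero.\<close>
  have "u < v"
    using signal_space_nodes_less[OF sig i_in] by simp
  then have "p + q = m0 \<and> p * u + q * v = m1 \<and> p * u\<^sup>2 + q * v\<^sup>2 = m2"
    using eq two_node_moments_iff[of u v p q m0 m1 m2] by (simp add: p_def q_def)
  moreover have "pair_moment i k F' = p * u ^ k + q * v ^ k" for k
    by (simp add: F'' pair_moment_eq)
  ultimately have "\<forall>k\<in>{0, 1, 2}. pair_moment i k F' = pair_moment i k (a, x)"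
    by (simp add: m0_def m1_def m2_def)
  moreover have "F' \<in> signal_space d"
    unfolding F'' by (intro signal_space_upd_amplitude i_in sig)
  ultimately show "F' \<in> ?C"
    unfolding prony_curve_pair_moment[OF i] by (simp add: F'')
qed

text \<open>The node curve is the part of the full conic \<open>H\<close> on which the nodes stay
  ordered; the bijection expresses the parametrization.\<close>

theorem theorem5p1:
  fixes d i :: nat and a x :: "nat \<Rightarrow> real"
  assumes "(a, x) \<in> signal_space d" and "1 \<le> i" and "i \<le> d - 1"
  shows "let m0 = pair_moment i 0 (a, x);
             m1 = pair_moment i 1 (a, x);
             m2 = pair_moment i 2 (a, x);
             H = {(u, v). m0 * u * v - m1 * (u + v) + m2 = 0}
         in prony_node_curve d (a, x) i =
              H \<inter> {(u, v). (a, x(i := u, i + 1 := v)) \<in> signal_space d} \<and>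
            (a i \<noteq> 0 \<and> a (i + 1) \<noteq> 0 \<and> m0 \<noteq> 0 \<longrightarrow> hyperbola H) \<and>
            bij_betw
              (\<lambda>(u, v).
                 (a(i := (m0 * v - m1) / (v - u), i + 1 := (- m0 * u + m1) / (v - u)),
                  x(i := u, i + 1 := v)))
              (prony_node_curve d (a, x) i) (prony_curve d (a, x) i)"
proof -
  define m0 m1 m2 where "m0 = pair_moment i 0 (a, x)" and "m1 = pair_moment i 1 (a, x)"
    and "m2 = pair_moment i 2 (a, x)"
  define H where "H = {(u, v). m0 * u * v - m1 * (u + v) + m2 = 0}"
  define D where "D = H \<inter> {(u, v). (a, x(i := u, i + 1 := v)) \<in> signal_space d}"
  define \<Phi> where "\<Phi> = (\<lambda>(u, v).
       (a(i := (m0 * v - m1) / (v - u), i + 1 := (- m0 * u + m1) / (v - u)),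
        x(i := u, i + 1 := v)))"
  have i: "1 \<le> i" "i + 1 \<le> d" using assms(2,3) by auto
  have curve: "prony_curve d (a, x) i = \<Phi> ` D"
    unfolding \<Phi>_def D_def H_def m0_def m1_def m2_def by (rule prony_curve_eq_image[OF assms(1) i])
  \<comment> \<open>Projection to the two moving nodes is a left inverse of \<open>\<Phi>\<close>,
    which yields both the node curve and injectivity.\<close>
  have nodes: "(snd (\<Phi> w) i, snd (\<Phi> w) (i + 1)) = w" for w
    by (cases w) (simp add: \<Phi>_def)
  have node_curve: "prony_node_curve d (a, x) i = D"
    unfolding prony_node_curve_def curve image_image nodes by simp
  have "inj_on \<Phi> D"
    by (rule inj_on_inverseI[where g = "\<lambda>F'. (snd F' i, snd F' (i + 1))"]) (rule nodes)
  then have bij: "bij_betw \<Phi> (prony_node_curve d (a, x) i) (prony_curve d (a, x) i)"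
    unfolding node_curve curve by (simp add: bij_betw_def)
  have hyp: "hyperbola H" if "a i \<noteq> 0" "a (i + 1) \<noteq> 0" "m0 \<noteq> 0"
  proof -
    have "x i < x (i + 1)"
      using assms(1) i by (intro signal_space_nodes_less) auto
    \<comment> \<open>Up to sign this is the Hankel determinant of the pair, which factors through
      the Vandermonde determinant of its nodes.\<close>
    moreover have "m1\<^sup>2 - m0 * m2 = - a i * a (i + 1) * (x (i + 1) - x i)\<^sup>2"
      by (simp add: m0_def m1_def m2_def pair_moment_eq power2_eq_square algebra_simps)
    ultimately have "m1\<^sup>2 \<noteq> m0 * m2"
      using that by auto
    with \<open>m0 \<noteq> 0\<close> show ?thesis
      unfolding H_def by (rule hyperbola_bilinear)
  qed
  show ?thesis
    unfolding Let_def
    using node_curve bij hyp unfolding D_def H_def \<Phi>_def m0_def m1_def m2_def by blast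
qed

end
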